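(* Let $A\in\mathbb{R}^{m\times n}$ have rows $a_1^\top,\dots,a_m^\top$, all nonzero, and let $b\in\mathbb{R}^m$ be such that the linear system $Ax=b$ is consistent. Let $x^{(0)}\in\mathbb{R}^n$ and let $x^\star=A^\dagger b+(I-A^\dagger A)x^{(0)}$ denote the orthogonal projection of $x^{(0)}$ onto the solution set of $Ax=b$. Let $\{x^{(k)}\}_{k\ge 0}$ be any iteration sequence generated by the greedy randomized Kaczmarz (GRK) method started at $x^{(0)}$. Then, deterministically (that is, for every realization of the random indices $i_k\in\mathcal{I}_k$), for every $k\ge 1$, $$\|x^{(k)}-x^\star\|_2^2\le\left(1-\frac12\left(\frac1\gamma\|A\|_F^2+1\right)\frac{\sigma_{\min}^2(A)}{\|A\|_F^2}\right)^{k-1}\left(1-\frac{\sigma_{\min}^2(A)}{\|A\|_F^2}\right)\|x^{(0)}-x^\star\|_2^2,$$ where $\gamma=\max_{i\in[m]}\sum_{j=1,\,j\ne i}^m\|a_j\|_2^2$.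
   Context: Notation: $[m]=\{1,\dots,m\}$; $a_i\in\mathbb{R}^n$ is the transpose of the $i$-th row of $A$; $b_i$ is the $i$-th entry of $b$; $A^\dagger$ is the Moore–Penrose pseudoinverse; $\|A\|_F$ is the Frobenius norm; $\sigma_{\min}(A)$ is the smallest nonzero singular value of $A$. The GRK method: starting from $x^{(0)}$, for $k=0,1,2,\dots$: set $$\mathcal{I}_k=\left\{i\in[m]:\frac{|\langle a_i,x^{(k)}\rangle-b_i|^2}{\|a_i\|_2^2}\ge\frac12\left(\max_{j\in[m]}\frac{|\langle a_j,x^{(k)}\rangle-b_j|^2}{\|a_j\|_2^2}+\frac{\|Ax^{(k)}-b\|_2^2}{\|A\|_F^2}\right)\right\};$$ let $\tilde r^{(k)}_i=\langle a_i,x^{(k)}\rangle-b_i$ if $i\in\mathcal{I}_k$ and $\tilde r^{(k)}_i=0$ otherwise; select $i_k\in\mathcal{I}_k$ with probability $\mathrm{Prob}(i_k=i)=|\tilde r_i^{(k)}|^2/\|\tilde r^{(k)}\|_2^2$; and set $x^{(k+1)}=x^{(k)}-\frac{\langle a_{i_k},x^{(k)}\rangle-b_{i_k}}{\|a_{i_k}\|_2^2}a_{i_k}$. Conventions: if $Ax^{(k)}=b$, then $x^{(k+1)}=x^{(k)}$. A zeroth power equals $1$. If $m=1$, so that $\gamma=0$, the right-hand side of the claim is read as $0$ (its factor $1-\sigma_{\min}^2(A)/\|A\|_F^2$ is $0$). *)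

theory Defs
  imports "HOL-Analysis.Analysis"
begin

definition frobenius_norm :: "real ^ 'n ^ 'm \<Rightarrow> real" where
  "frobenius_norm A = sqrt (\<Sum>i\<in>UNIV. \<Sum>j\<in>UNIV. (A $ i $ j)\<^sup>2)"

text \<open>The four Penrose conditions; they determine \<open>X\<close> uniquely.\<close>

definition is_pseudoinverse :: "real ^ 'n ^ 'm \<Rightarrow> real ^ 'm ^ 'n \<Rightarrow> bool" where
  "is_pseudoinverse A X \<longleftrightarrow>
     A ** X ** A = A \<and>
     X ** A ** X = X \<and>
     transpose (A ** X) = A ** X \<and>
     transpose (X ** A) = X ** A"

definition pseudoinverse :: "real ^ 'n ^ 'm \<Rightarrow> real ^ 'm ^ 'n" where
  "pseudoinverse A = (THE X. is_pseudoinverse A X)"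

text \<open>
  Singular values are the nonnegative square roots of the eigenvalues of \<open>A\<^sup>T A\<close>.
  The zero singular value, whose presence depends on whether \<open>A\<^sup>T A\<close> or
  \<open>A A\<^sup>T\<close> is used, plays no role in \<open>sigma_min\<close>.
\<close>

definition singular_values :: "real ^ 'n ^ 'm \<Rightarrow> real set" where
  "singular_values A =
     {s. s \<ge> 0 \<and> (\<exists>v. v \<noteq> 0 \<and> (transpose A ** A) *v v = s\<^sup>2 *\<^sub>R v)}"

definition sigma_min :: "real ^ 'n ^ 'm \<Rightarrow> real" where
  "sigma_min A = Min {s \<in> singular_values A. s \<noteq> 0}"

definition grk_loss :: "real ^ 'n ^ 'm \<Rightarrow> real ^ 'm \<Rightarrow> real ^ 'n \<Rightarrow> 'm \<Rightarrow> real" where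
  "grk_loss A b x i = \<bar>row i A \<bullet> x - b $ i\<bar>\<^sup>2 / (norm (row i A))\<^sup>2"

definition grk_index_set :: "real ^ 'n ^ 'm \<Rightarrow> real ^ 'm \<Rightarrow> real ^ 'n \<Rightarrow> 'm set" where
  "grk_index_set A b x =
     {i. grk_loss A b x i \<ge>
           1 / 2 * (Max (range (grk_loss A b x))
                    + (norm (A *v x - b))\<^sup>2 / (frobenius_norm A)\<^sup>2)}"

text \<open>
  \<open>x\<close> is the trajectory of the greedy randomized Kaczmarz method along the realization
  \<open>idx\<close> of the random indices. The method draws \<open>i\<close> from the index set with probability
  proportional to the squared residual of row \<open>i\<close>. If \<open>A *v x k \<noteq> b\<close>, then every row in the
  index set has nonzero residual, so the possible values of \<open>idx k\<close> are exactly the elements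
  of the index set.
\<close>

definition grk_sequence ::
    "real ^ 'n ^ 'm \<Rightarrow> real ^ 'm \<Rightarrow> (nat \<Rightarrow> 'm) \<Rightarrow> (nat \<Rightarrow> real ^ 'n) \<Rightarrow> bool" where
  "grk_sequence A b idx x \<longleftrightarrow>
     (\<forall>k. if A *v x k = b then x (Suc k) = x k
          else idx k \<in> grk_index_set A b (x k) \<and>
               x (Suc k) = x k - ((row (idx k) A \<bullet> x k - b $ idx k) / (norm (row (idx k) A))\<^sup>2)
                                   *\<^sub>R row (idx k) A)"

text \<open>
  For a single row this is \<open>0\<close>, and \<open>1 / grk_gamma A = 0\<close> in HOL. The bound then still reads \<open>0\<close>,
  because \<open>(sigma_min A)\<^sup>2 = (frobenius_norm A)\<^sup>2\<close> for a matrix with one nonzero row.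
\<close>

definition grk_gamma :: "real ^ 'n ^ 'm \<Rightarrow> real" where
  "grk_gamma A = Max (range (\<lambda>i. \<Sum>j\<in>UNIV - {i}. (norm (row j A))\<^sup>2))"

end

(*
  Each step lowers the squared error by the loss of the chosen row, which is at least the
  average of the maximal loss and |Ax - b|^2 / |A|_F^2. The residual is a combination of the
  losses with weights |a_i|^2, so the maximal loss is at least |Ax - b|^2 / |A|_F^2. After the
  first step the row used last has zero residual and drops out of this combination, which
  improves |A|_F^2 to gamma. The errors stay in the row space, where |Av| >= sigma_min |v|.

  The contraction factor can be negative only if all rows are parallel. Then
  sigma_min^2 = |A|_F^2, so the first step already reaches the solution.
*)
theory Submission
  imports Defs
begin

section \<open>The Moore--Penrose pseudoinverse\<close>

lemma inner_matrix_vector_transpose: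
  fixes A :: "real ^ 'n ^ 'm"
  shows "(A *v x) \<bullet> y = x \<bullet> (transpose A *v y)"
  by (metis dot_lmul_matrix inner_commute transpose_matrix_vector)

text \<open>The component \<open>z\<close> orthogonal to the row space is orthogonal to A^T(Az) in
  particular, which says |Az|^2 = 0.\<close>

lemma row_space_kernel_decomp:
  fixes A :: "real ^ 'n ^ 'm"
  obtains w z where "x = transpose A *v w + z" "A *v z = 0"
proof -
  let ?R = "range ((*v) (transpose A))"
  have sub: "span ?R = ?R"
    by (metis linear_subspace_image matrix_vector_mul_linear span_eq_iff subspace_UNIV)
  obtain y z where y: "y \<in> span ?R" and z: "\<And>w. w \<in> span ?R \<Longrightarrow> orthogonal z w"
    and x: "x = y + z"
    using orthogonal_subspace_decomp_exists by metis
  from y obtain w where w: "y = transpose A *v w" unfolding sub by auto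
  have "orthogonal z (transpose A *v (A *v z))"
    using z unfolding sub by blast
  then have "(A *v z) \<bullet> (A *v z) = 0"
    by (simp add: inner_matrix_vector_transpose orthogonal_def)
  then show thesis using that x w by simp
qed

text \<open>|A^T w|^2 = w . (A A^T w). So \<open>A\<close> is injective on its row space, which is
  why errors kept in that space are controlled by the residual.\<close>

lemma row_space_kernel_trivial:
  fixes A :: "real ^ 'n ^ 'm"
  assumes "A *v (transpose A *v w) = 0"
  shows "transpose A *v w = 0"
proof -
  have "(transpose A *v w) \<bullet> (transpose A *v w) = w \<bullet> (A *v (transpose A *v w))"
    by (metis inner_matrix_vector_transpose transpose_transpose)
  then show ?thesis using assms by simp
qed

text \<open>AX and AY are both the orthogonal projection onto the range of \<open>A\<close>, and XA
  and YA both the one onto the row space. Hence X = XAX = XAY = YAY = Y.\<close>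

lemma pseudoinverse_unique:
  fixes A :: "real ^ 'n ^ 'm"
  assumes X: "is_pseudoinverse A X" and Y: "is_pseudoinverse A Y"
  shows "X = Y"
proof -
  have X': "A ** X ** A = A" "X ** A ** X = X"
    "transpose (A ** X) = A ** X" "transpose (X ** A) = X ** A"
    and Y': "A ** Y ** A = A" "Y ** A ** Y = Y"
    "transpose (A ** Y) = A ** Y" "transpose (Y ** A) = Y ** A"
    using X Y by (auto simp: is_pseudoinverse_def)
  have "A ** X = (A ** Y) ** (A ** X)"
    using Y'(1) by (simp add: matrix_mul_assoc)
  also have "\<dots> = transpose ((A ** X) ** (A ** Y))"
    by (simp add: matrix_transpose_mul[of "A ** X"] X' Y')
  also have "(A ** X) ** (A ** Y) = A ** Y"
    using X'(1) by (simp add: matrix_mul_assoc)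
  finally have AX: "A ** X = A ** Y" using Y' by simp
  have "X ** A = (X ** A) ** (Y ** A)"
    using Y'(1) by (metis matrix_mul_assoc)
  also have "\<dots> = transpose ((Y ** A) ** (X ** A))"
    by (simp add: matrix_transpose_mul[of "Y ** A"] X' Y')
  also have "(Y ** A) ** (X ** A) = Y ** A"
    using X'(1) by (metis matrix_mul_assoc)
  finally have XA: "X ** A = Y ** A" using Y' by simp
  show ?thesis by (metis AX XA X'(2) Y'(2) matrix_mul_assoc)
qed

text \<open>Only the range part Au of a right-hand side \<open>y\<close> survives under A^T, and
  only the row space part of \<open>u\<close> survives under \<open>A\<close>. Writing the unknown
  as A^T W keeps its columns in the row space.\<close>

lemma normal_equation_solvable:
  fixes A :: "real ^ 'n ^ 'm"
  obtains W where "transpose A ** (A ** (transpose A ** W)) = transpose A"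
proof -
  have "\<exists>w. transpose A *v (A *v (transpose A *v w)) = transpose A *v y" for y
  proof -
    obtain u z where y: "y = A *v u + z" and z: "transpose A *v z = 0"
      using row_space_kernel_decomp[of y "transpose A"] by (metis transpose_transpose)
    obtain w z' where u: "u = transpose A *v w + z'" and z': "A *v z' = 0"
      using row_space_kernel_decomp[of u A] by metis
    have "A *v u = A *v (transpose A *v w)"
      using u z' by (simp add: matrix_vector_right_distrib)
    then show ?thesis
      using y z by (auto simp: matrix_vector_right_distrib)
  qed
  then obtain f where f: "\<And>y. transpose A *v (A *v (transpose A *v f y)) = transpose A *v y"
    by metis
  \<comment> \<open>The columns of \<open>W\<close> are the solutions for the standard basis
    vectors, since the chosen \<open>f\<close> need not be linear.\<close>
  define W where "W = (\<chi> i j. f (axis j 1) $ i)"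
  have W: "W *v axis j 1 = f (axis j 1)" for j
    by (simp add: W_def matrix_vector_mul_component matrix_vector_mult_basis column_def vec_eq_iff)
  have "column j (transpose A ** (A ** (transpose A ** W))) = column j (transpose A)" for j
    unfolding matrix_vector_mult_basis[symmetric]
    by (simp only: matrix_vector_mul_assoc[symmetric] W f)
  then have "transpose A ** (A ** (transpose A ** W)) = transpose A"
    by (simp add: vec_eq_iff column_def)
  then show thesis by (rule that)
qed

text \<open>X = A^T W solves the normal equation A^T A X = A^T. Transposed, this gives P^T P = P for
  P = AX, and P^T P is symmetric. The matrix XA is handled likewise.\<close>

lemma pseudoinverse_exists:
  fixes A :: "real ^ 'n ^ 'm"
  shows "\<exists>X. is_pseudoinverse A X"
proof -
  obtain W where W: "transpose A ** (A ** (transpose A ** W)) = transpose A"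
    by (rule normal_equation_solvable)
  define X where "X = transpose A ** W"
  have "transpose (transpose A ** (A ** X)) = A"
    using W by (simp add: X_def)
  then have PA: "transpose (A ** X) ** A = A"
    by (simp add: matrix_transpose_mul matrix_mul_assoc)
  then have "transpose (A ** X) ** (A ** X) = A ** X"
    by (simp add: matrix_mul_assoc)
  then have sym1: "transpose (A ** X) = A ** X"
    by (metis matrix_transpose_mul transpose_transpose)
  have AXA: "A ** X ** A = A" using PA sym1 by simp
  have XA: "X ** A = transpose A ** (W ** A)"
    by (simp add: X_def matrix_mul_assoc)
  then have tXA: "transpose (X ** A) = transpose (W ** A) ** A"
    by (simp only: matrix_transpose_mul transpose_transpose)
  have "transpose (X ** A) ** (X ** A) = transpose (W ** A) ** (A ** X ** A)"
    unfolding tXA by (simp only: matrix_mul_assoc)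
  also have "\<dots> = transpose (X ** A)"
    by (simp only: AXA tXA)
  finally have sym2: "transpose (X ** A) = X ** A"
    by (metis matrix_transpose_mul transpose_transpose)
  \<comment> \<open>The difference of the two sides lies both in the row space and in the kernel of
    \<open>A\<close>.\<close>
  have "X *v (A *v (X *v v)) = X *v v" for v
  proof -
    have "X *v (A *v (X *v v)) - X *v v = transpose A *v (W *v (A *v (X *v v)) - W *v v)"
      by (simp add: X_def matrix_vector_mul_assoc[symmetric] matrix_vector_mult_diff_distrib)
    moreover have "A *v (X *v (A *v (X *v v)) - X *v v) = 0"
      by (simp add: AXA matrix_vector_mul_assoc matrix_vector_mult_diff_distrib matrix_mul_assoc)
    ultimately show ?thesis
      using row_space_kernel_trivial by (metis eq_iff_diff_eq_0)
  qed
  then have "X ** A ** X = X"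
    by (simp add: matrix_eq matrix_vector_mul_assoc matrix_mul_assoc)
  then show ?thesis using AXA sym1 sym2 unfolding is_pseudoinverse_def by blast
qed

lemma pseudoinverse_is_pseudoinverse: "is_pseudoinverse A (pseudoinverse A)"
proof -
  have "\<exists>!X. is_pseudoinverse A X"
    using pseudoinverse_exists[of A] pseudoinverse_unique[of A] by (auto intro: ex_ex1I)
  then show ?thesis unfolding pseudoinverse_def by (rule theI')
qed

text \<open>X = (XA)X = (XA)^T X = A^T X^T X. This places the initial error in the row
  space.\<close>

lemma pseudoinverse_in_row_space: "\<exists>w. pseudoinverse A *v v = transpose A *v w"
proof -
  let ?X = "pseudoinverse A"
  have "?X = transpose (?X ** A) ** ?X"
    using pseudoinverse_is_pseudoinverse[of A] by (simp add: is_pseudoinverse_def)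
  then have "?X *v v = transpose A *v (transpose ?X *v (?X *v v))"
    by (metis matrix_transpose_mul matrix_vector_mul_assoc)
  then show ?thesis by blast
qed

lemma pseudoinverse_projection_solves:
  assumes "\<exists>y. A *v y = b"
  shows "A *v (pseudoinverse A *v b + (mat 1 - pseudoinverse A ** A) *v z) = b"
proof -
  let ?X = "pseudoinverse A"
  have AXA: "A *v (?X *v (A *v y)) = A *v y" for y
    using pseudoinverse_is_pseudoinverse[of A]
    by (simp add: is_pseudoinverse_def matrix_vector_mul_assoc matrix_mul_assoc)
  obtain y where "b = A *v y" using assms by auto
  then show ?thesis
    by (simp add: AXA matrix_vector_right_distrib matrix_vector_mult_diff_rdistrib
        matrix_vector_mult_diff_distrib matrix_vector_mul_assoc[symmetric])
qed

section \<open>The smallest nonzero singular value\<close>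

lemma linear_term_zero_if_quadratic_nonneg:
  fixes p c :: real
  assumes "\<And>t. 0 \<le> 2 * t * p + t\<^sup>2 * c"
  shows "p = 0"
proof (rule ccontr)
  assume p: "p \<noteq> 0"
  \<comment> \<open>With c < 2d, the quadratic at t = -p/d equals p^2 (c - 2d) / d^2 and is
    negative.\<close>
  define d where "d = \<bar>c\<bar> + 1"
  have d: "d > 0" "c < 2 * d" by (auto simp: d_def)
  have "2 * (- p / d) * p + (- p / d)\<^sup>2 * c = p\<^sup>2 * (c - 2 * d) / d\<^sup>2"
    using d(1) by (simp add: divide_simps power2_eq_square) (simp add: algebra_simps)
  also have "\<dots> < 0"
    using p d by (intro divide_neg_pos mult_pos_neg) auto
  finally show False using assms[of "- p / d"] by simp
qed

lemma norm_add_scaleR_square: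
  "(norm (v + t *\<^sub>R u))\<^sup>2 = (norm v)\<^sup>2 + 2 * t * (v \<bullet> u) + t\<^sup>2 * (norm u)\<^sup>2"
  unfolding power2_norm_eq_inner
  by (simp add: inner_left_distrib inner_right_distrib inner_commute algebra_simps
      power2_eq_square)

lemma inner_gram:
  fixes A :: "real ^ 'n ^ 'm"
  shows "((transpose A ** A) *v v) \<bullet> w = (A *v v) \<bullet> (A *v w)"
  by (metis inner_commute inner_matrix_vector_transpose matrix_vector_mul_assoc)

lemma inner_eigenvectors:
  fixes A :: "real ^ 'n ^ 'm"
  assumes "(transpose A ** A) *v v = s *\<^sub>R v"
  shows "(A *v v) \<bullet> (A *v w) = s * (v \<bullet> w)"
  using inner_gram[of A v w] by (simp add: assms)

lemma norm_eigenvector: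
  fixes A :: "real ^ 'n ^ 'm"
  assumes "(transpose A ** A) *v v = s *\<^sub>R v"
  shows "(norm (A *v v))\<^sup>2 = s * (norm v)\<^sup>2"
  using inner_eigenvectors[OF assms, of v] by (simp add: power2_norm_eq_inner)

text \<open>Eigenvectors of A^T A for distinct eigenvalues are orthogonal, hence independent.
  Finiteness gives the \<open>Min\<close> in \<open>sigma_min\<close> its meaning.\<close>

lemma finite_singular_values:
  fixes A :: "real ^ 'n ^ 'm"
  shows "finite (singular_values A)"
proof -
  have "\<forall>s\<in>singular_values A. \<exists>v. v \<noteq> 0 \<and> (transpose A ** A) *v v = s\<^sup>2 *\<^sub>R v"
    by (simp add: singular_values_def)
  then obtain f where f: "\<And>s. s \<in> singular_values A \<Longrightarrow>
      f s \<noteq> 0 \<and> (transpose A ** A) *v f s = s\<^sup>2 *\<^sub>R f s"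
    by metis
  have orth: "f s \<bullet> f t = 0" if "s \<in> singular_values A" "t \<in> singular_values A" "s \<noteq> t" for s t
  proof -
    have "s\<^sup>2 * (f s \<bullet> f t) = t\<^sup>2 * (f s \<bullet> f t)"
      using inner_eigenvectors[of A "f s" "s\<^sup>2" "f t"] inner_eigenvectors[of A "f t" "t\<^sup>2" "f s"] f that
      by (simp add: inner_commute)
    \<comment> \<open>Singular values are nonnegative, so squaring is injective on them.\<close>
    moreover have "s\<^sup>2 \<noteq> t\<^sup>2" using that by (auto simp: singular_values_def)
    ultimately show ?thesis by simp
  qed
  have inj: "inj_on f (singular_values A)"
    using orth f by (metis inj_onI inner_eq_zero_iff)
  have "pairwise orthogonal (f ` singular_values A)"
    using orth by (auto simp: pairwise_def orthogonal_def)
  then have "independent (f ` singular_values A)"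
    using f by (intro pairwise_orthogonal_independent) auto
  then show ?thesis
    using inj finite_imageD independent_imp_finite by blast
qed

text \<open>Variational characterization: |Av|^2 attains a minimum \<open>l\<close> on the unit
  sphere of the row space. A minimizer is an eigenvector of A^T A for \<open>l\<close>, and sqrt(l)
  turns out to be the least nonzero singular value.\<close>

lemma sigma_min_properties:
  fixes A :: "real ^ 'n ^ 'm"
  assumes "A \<noteq> 0"
  shows sigma_min_singular_value: "sigma_min A \<in> singular_values A"
    and sigma_min_nonzero: "sigma_min A \<noteq> 0"
    and sigma_min_le_row_space:
      "\<And>w. (sigma_min A)\<^sup>2 * (norm (transpose A *v w))\<^sup>2 \<le> (norm (A *v (transpose A *v w)))\<^sup>2"
proof -
  let ?R = "range ((*v) (transpose A))"
  have sub: "subspace ?R"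
    by (metis linear_subspace_image matrix_vector_mul_linear subspace_UNIV)
  have "compact (?R \<inter> sphere 0 1)"
    using sub by (intro closed_Int_compact closed_subspace) auto
  moreover have "?R \<inter> sphere 0 1 \<noteq> {}"
  proof -
    have "transpose A \<noteq> 0"
      using assms by (auto simp: transpose_def vec_eq_iff)
    then obtain w where w: "transpose A *v w \<noteq> 0"
      by (metis matrix_eq matrix_vector_mult_0)
    define u where "u = transpose A *v w"
    have "(1 / norm u) *\<^sub>R u \<in> ?R"
      using sub by (intro subspace_scale) (auto simp: u_def)
    moreover have "norm ((1 / norm u) *\<^sub>R u) = 1" using w by (simp add: u_def)
    ultimately show ?thesis by fastforce
  qed
  moreover have "continuous_on (?R \<inter> sphere 0 1) (\<lambda>v. (norm (A *v v))\<^sup>2)"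
    by (intro continuous_intros linear_continuous_on linear_linear[THEN iffD2]
        matrix_vector_mul_linear)
  ultimately obtain v where "v \<in> ?R \<inter> sphere 0 1"
    and min: "\<forall>u\<in>?R \<inter> sphere 0 1. (norm (A *v v))\<^sup>2 \<le> (norm (A *v u))\<^sup>2"
    using continuous_attains_inf[of "?R \<inter> sphere 0 1" "\<lambda>v. (norm (A *v v))\<^sup>2"] by blast
  then have v: "v \<in> ?R" "norm v = 1" by auto
  have vmin: "(norm (A *v v))\<^sup>2 \<le> (norm (A *v u))\<^sup>2" if "u \<in> ?R" "norm u = 1" for u
    using min that by simp
  define l where "l = (norm (A *v v))\<^sup>2"
  have lower: "l * (norm u)\<^sup>2 \<le> (norm (A *v u))\<^sup>2" if "u \<in> ?R" for u
  proof (cases "u = 0")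
    case False
    have "(1 / norm u) *\<^sub>R u \<in> ?R" using sub that by (rule subspace_scale)
    then have "l \<le> (norm (A *v ((1 / norm u) *\<^sub>R u)))\<^sup>2"
      unfolding l_def by (rule vmin) (use False in simp)
    then show ?thesis
      using False by (simp add: scaleR_matrix_vector_assoc[symmetric]
          matrix_vector_mult_scaleR field_simps)
  qed simp
  \<comment> \<open>Along v + tu the bound \<open>lower\<close> is an equality at t = 0, so the term
    linear in \<open>t\<close> vanishes.\<close>
  have stationary: "(A *v v) \<bullet> (A *v u) - l * (v \<bullet> u) = 0" if u: "u \<in> ?R" for u
  proof (rule linear_term_zero_if_quadratic_nonneg)
    fix t :: real
    have "v + t *\<^sub>R u \<in> ?R"
      using sub u v by (intro subspace_add subspace_scale)
    from lower[OF this]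
    show "0 \<le> 2 * t * ((A *v v) \<bullet> (A *v u) - l * (v \<bullet> u))
              + t\<^sup>2 * ((norm (A *v u))\<^sup>2 - l * (norm u)\<^sup>2)"
      using v(2) by (simp add: matrix_vector_right_distrib matrix_vector_mult_scaleR
          norm_add_scaleR_square l_def[symmetric] algebra_simps)
  qed
  \<comment> \<open>The defect \<open>d\<close> of the eigenvalue equation lies in the row space
    itself, so stationarity may be tested against \<open>d\<close> and gives |d|^2 = 0.\<close>
  define d where "d = (transpose A ** A) *v v - l *\<^sub>R v"
  have dR: "d \<in> ?R"
    unfolding d_def using sub v
    by (intro subspace_diff subspace_scale) (auto simp: matrix_vector_mul_assoc[symmetric])
  have "d \<bullet> d = (A *v v) \<bullet> (A *v d) - l * (v \<bullet> d)"
    by (subst (1) d_def) (simp add: inner_diff_left inner_gram)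
  also have "\<dots> = 0" using stationary[OF dR] .
  finally have eig: "(transpose A ** A) *v v = l *\<^sub>R v" by (simp add: d_def)
  \<comment> \<open>If \<open>l\<close> were 0, the unit vector \<open>v\<close> would lie in the
    row space and in the kernel.\<close>
  have l0: "l > 0"
    using v row_space_kernel_trivial by (fastforce simp: l_def)
  have mem: "sqrt l \<in> {s \<in> singular_values A. s \<noteq> 0}"
    using l0 eig v(2) by (auto simp: singular_values_def intro!: exI[of _ v])
  have "sqrt l \<le> s" if s: "s \<in> singular_values A" "s \<noteq> 0" for s
  proof -
    obtain u where u: "u \<noteq> 0" "(transpose A ** A) *v u = s\<^sup>2 *\<^sub>R u" and s0: "s \<ge> 0"
      using s by (auto simp: singular_values_def)
    \<comment> \<open>Eigenvectors for nonzero eigenvalues lie in the row space, so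
      \<open>lower\<close> applies to them.\<close>
    have "u = (1 / s\<^sup>2) *\<^sub>R (transpose A *v (A *v u))"
      using u(2) s(2) by (simp add: matrix_vector_mul_assoc)
    then have "u \<in> ?R"
      by (metis sub subspace_scale rangeI)
    then have "l * (norm u)\<^sup>2 \<le> s\<^sup>2 * (norm u)\<^sup>2"
      using lower norm_eigenvector[OF u(2)] by metis
    then have "l \<le> s\<^sup>2" using u(1) by simp
    then show ?thesis using s0 by (simp add: real_le_lsqrt)
  qed
  then have sm: "sigma_min A = sqrt l"
    unfolding sigma_min_def using mem finite_singular_values[of A] by (intro Min_eqI) auto
  show "sigma_min A \<in> singular_values A" "sigma_min A \<noteq> 0" using mem sm by auto
  show "(sigma_min A)\<^sup>2 * (norm (transpose A *v w))\<^sup>2 \<le> (norm (A *v (transpose A *v w)))\<^sup>2" for w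
    using lower[of "transpose A *v w"] l0 by (simp add: sm)
qed

section \<open>Row norms\<close>

lemma matrix_vector_row: "(A *v v) $ i = row i A \<bullet> (v :: real ^ 'n)"
  by (simp add: matrix_vector_mul_component row_def)

lemma norm_matrix_vector_rows:
  fixes A :: "real ^ 'n ^ 'm"
  shows "(norm (A *v v))\<^sup>2 = (\<Sum>i\<in>UNIV. (row i A \<bullet> v)\<^sup>2)"
  unfolding power2_norm_eq_inner inner_vec_def[of "A *v v"]
  by (simp add: matrix_vector_row power2_eq_square)

lemma frobenius_norm_rows:
  fixes A :: "real ^ 'n ^ 'm"
  shows "(frobenius_norm A)\<^sup>2 = (\<Sum>i\<in>UNIV. (norm (row i A))\<^sup>2)"
  unfolding frobenius_norm_def power2_norm_eq_inner inner_vec_def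
  by (simp add: sum_nonneg row_def power2_eq_square)

lemma row_in_row_space: "row i A = transpose A *v axis i (1::real)"
  by (simp add: matrix_vector_mult_basis column_transpose)

lemma inner_square_le: "(u \<bullet> v)\<^sup>2 \<le> (norm u)\<^sup>2 * (norm v)\<^sup>2"
  using Cauchy_Schwarz_ineq[of u v] by (simp add: power2_norm_eq_inner)

text \<open>Cauchy-Schwarz, row by row, at an eigenvector for \<open>sigma_min A\<close>.\<close>

lemma sigma_min_le_frobenius:
  fixes A :: "real ^ 'n ^ 'm"
  assumes "A \<noteq> 0"
  shows "(sigma_min A)\<^sup>2 \<le> (frobenius_norm A)\<^sup>2"
proof -
  obtain v where v: "v \<noteq> 0" "(transpose A ** A) *v v = (sigma_min A)\<^sup>2 *\<^sub>R v"
    using sigma_min_singular_value[OF assms] by (auto simp: singular_values_def)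
  have "(sigma_min A)\<^sup>2 * (norm v)\<^sup>2 = (\<Sum>i\<in>UNIV. (row i A \<bullet> v)\<^sup>2)"
    using norm_eigenvector[OF v(2)] norm_matrix_vector_rows[of A v] by simp
  also have "\<dots> \<le> (frobenius_norm A)\<^sup>2 * (norm v)\<^sup>2"
    by (simp add: frobenius_norm_rows sum_distrib_right sum_mono inner_square_le)
  finally show ?thesis using v(1) by simp
qed

lemma row_sum_le_grk_gamma:
  fixes A :: "real ^ 'n ^ 'm"
  shows "(\<Sum>j\<in>UNIV - {i}. (norm (row j A))\<^sup>2) \<le> grk_gamma A"
  unfolding grk_gamma_def by (intro Max_ge) auto

lemma grk_gamma_nonneg: "0 \<le> grk_gamma A"
  by (rule order_trans[OF sum_nonneg row_sum_le_grk_gamma]) simp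

text \<open>
  On a direction of the row space orthogonal to row \<open>i\<close>, only the other rows act. If there is no
  such direction, all rows are parallel to row \<open>i\<close>.
\<close>

lemma sigma_min_le_gamma_or_rank_one:
  fixes A :: "real ^ 'n ^ 'm"
  assumes rows: "\<And>i. row i A \<noteq> 0"
  shows "(sigma_min A)\<^sup>2 \<le> grk_gamma A \<or> (sigma_min A)\<^sup>2 = (frobenius_norm A)\<^sup>2"
proof -
  fix i :: 'm
  define a where "a = row i A"
  have A0: "A \<noteq> 0" using rows[of i] by (auto simp: row_def vec_eq_iff)
  have aa: "a \<bullet> a \<noteq> 0" using rows by (simp add: a_def)
  show ?thesis
  proof (cases "\<forall>j. \<exists>c. row j A = c *\<^sub>R a")
    case True
    then obtain c where c: "\<And>j. row j A = c j *\<^sub>R a" by metis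
    have F: "(frobenius_norm A)\<^sup>2 = (\<Sum>j\<in>UNIV. (c j)\<^sup>2) * (norm a)\<^sup>2"
      by (simp add: frobenius_norm_rows sum_distrib_right c power_mult_distrib)
    obtain v where v: "v \<noteq> 0" "(transpose A ** A) *v v = (sigma_min A)\<^sup>2 *\<^sub>R v"
      using sigma_min_singular_value[OF A0] by (auto simp: singular_values_def)
    have N: "(norm (A *v u))\<^sup>2 = (\<Sum>j\<in>UNIV. (c j)\<^sup>2) * (a \<bullet> u)\<^sup>2" for u
      by (simp add: norm_matrix_vector_rows sum_distrib_right c power_mult_distrib)
    have "A *v v \<noteq> 0"
      using norm_eigenvector[OF v(2)] sigma_min_nonzero[OF A0] v(1) by auto
    then have av: "a \<bullet> v \<noteq> 0" using N[of v] by auto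
    \<comment> \<open>Here \<open>a\<close> is an eigenvector of A^T A for |A|_F^2. Pairing it with
      \<open>v\<close>, to which it is not orthogonal, forces the two eigenvalues to agree.\<close>
    have "(sigma_min A)\<^sup>2 * (v \<bullet> a) = (A *v v) \<bullet> (A *v a)"
      using inner_eigenvectors[OF v(2)] by simp
    also have "\<dots> = (\<Sum>j\<in>UNIV. (row j A \<bullet> v) * (row j A \<bullet> a))"
      by (simp add: inner_vec_def[of "A *v v"] matrix_vector_row)
    also have "\<dots> = (\<Sum>j\<in>UNIV. (c j)\<^sup>2 * ((a \<bullet> v) * (a \<bullet> a)))"
      by (simp add: c power2_eq_square mult_ac)
    also have "\<dots> = (frobenius_norm A)\<^sup>2 * (v \<bullet> a)"
      by (simp add: F sum_distrib_right[symmetric] power2_norm_eq_inner inner_commute)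
    finally show ?thesis using av by (simp add: inner_commute)
  next
    case False
    then obtain j where j: "\<And>c. row j A \<noteq> c *\<^sub>R a" by auto
    \<comment> \<open>Gram-Schmidt: \<open>v\<close> is the part of row \<open>j\<close> orthogonal
      to \<open>a\<close>, nonzero because the rows are not parallel.\<close>
    define c where "c = (a \<bullet> row j A) / (a \<bullet> a)"
    define v where "v = row j A - c *\<^sub>R a"
    have v0: "v \<noteq> 0" using j by (simp add: v_def)
    have av: "a \<bullet> v = 0" using aa by (simp add: v_def c_def inner_diff_right)
    have vR: "v = transpose A *v (axis j 1 - c *\<^sub>R axis i 1)"
      by (simp add: v_def a_def row_in_row_space matrix_vector_mult_diff_distrib
          matrix_vector_mult_scaleR)
    have "(sigma_min A)\<^sup>2 * (norm v)\<^sup>2 \<le> (norm (A *v v))\<^sup>2"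
      unfolding vR by (rule sigma_min_le_row_space[OF A0])
    also have "\<dots> = (\<Sum>k\<in>UNIV - {i}. (row k A \<bullet> v)\<^sup>2)"
      by (simp add: norm_matrix_vector_rows sum.remove[of UNIV i] av[unfolded a_def])
    also have "\<dots> \<le> (\<Sum>k\<in>UNIV - {i}. (norm (row k A))\<^sup>2) * (norm v)\<^sup>2"
      by (simp add: sum_distrib_right sum_mono inner_square_le)
    also have "\<dots> \<le> grk_gamma A * (norm v)\<^sup>2"
      by (intro mult_right_mono row_sum_le_grk_gamma) simp
    finally show ?thesis using v0 by simp
  qed
qed

section \<open>One Kaczmarz step\<close>

text \<open>In terms of a solution \<open>z\<close>, the loss is the squared length of the component
  of the error along row \<open>i\<close>, which is what one step removes.\<close>

lemma grk_loss_solution: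
  assumes "A *v z = b"
  shows "grk_loss A b y i = (row i A \<bullet> (y - z))\<^sup>2 / (norm (row i A))\<^sup>2"
  using matrix_vector_row[of A z i] assms
  by (simp add: grk_loss_def inner_diff_right)

text \<open>The step projects orthogonally onto the hyperplane of equation \<open>i\<close>, which
  contains \<open>z\<close>; the first claim is Pythagoras. The second lets this row be dropped from
  the next residual.\<close>

lemma kaczmarz_step_error:
  fixes A :: "real ^ 'n ^ 'm"
  assumes row: "row i A \<noteq> 0" and z: "A *v z = b"
    and y': "y' = y - ((row i A \<bullet> y - b $ i) / (norm (row i A))\<^sup>2) *\<^sub>R row i A"
  shows "(norm (y' - z))\<^sup>2 = (norm (y - z))\<^sup>2 - grk_loss A b y i"
    and "row i A \<bullet> (y' - z) = 0"
proof -
  let ?a = "row i A"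
  define c where "c = (?a \<bullet> (y - z)) / (norm ?a)\<^sup>2"
  have c: "c * (norm ?a)\<^sup>2 = ?a \<bullet> (y - z)" using row by (simp add: c_def)
  have y'z: "y' - z = (y - z) - c *\<^sub>R ?a"
    using matrix_vector_row[of A z i] z by (simp add: y' c_def inner_diff_right)
  have "(norm (y' - z))\<^sup>2 = (norm (y - z))\<^sup>2 - 2 * c * (?a \<bullet> (y - z)) + c\<^sup>2 * (norm ?a)\<^sup>2"
    using norm_add_scaleR_square[of "y - z" "- c" ?a] by (simp add: y'z inner_commute)
  also have "c\<^sup>2 * (norm ?a)\<^sup>2 = c * (?a \<bullet> (y - z))"
    unfolding c[symmetric] by (simp add: power2_eq_square)
  also have "c * (?a \<bullet> (y - z)) = grk_loss A b y i"
    unfolding grk_loss_solution[OF z] c_def by (simp add: power2_eq_square)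
  finally show "(norm (y' - z))\<^sup>2 = (norm (y - z))\<^sup>2 - grk_loss A b y i"
    unfolding grk_loss_solution[OF z] c_def by (simp add: power2_eq_square)
  show "?a \<bullet> (y' - z) = 0"
    unfolding y'z inner_diff_right[of _ "y - z"] using c by (simp add: power2_norm_eq_inner)
qed

text \<open>\<open>J\<close> holds the rows that may still have a residual: all rows at the first
  step, all but the row used last afterwards.\<close>

lemma residual_le_max_loss:
  fixes A :: "real ^ 'n ^ 'm"
  assumes rows: "\<And>i. row i A \<noteq> 0" and z: "A *v z = b"
    and zero: "\<And>j. j \<notin> J \<Longrightarrow> row j A \<bullet> (y - z) = 0"
  shows "(norm (A *v y - b))\<^sup>2 \<le> Max (range (grk_loss A b y)) * (\<Sum>j\<in>J. (norm (row j A))\<^sup>2)"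
proof -
  have "A *v y - b = A *v (y - z)" using z by (simp add: matrix_vector_mult_diff_distrib)
  then have "(norm (A *v y - b))\<^sup>2 = (\<Sum>j\<in>UNIV. (row j A \<bullet> (y - z))\<^sup>2)"
    by (simp add: norm_matrix_vector_rows)
  also have "\<dots> = (\<Sum>j\<in>J. (row j A \<bullet> (y - z))\<^sup>2)"
    by (rule sum.mono_neutral_right) (use zero in auto)
  also have "\<dots> = (\<Sum>j\<in>J. grk_loss A b y j * (norm (row j A))\<^sup>2)"
    by (simp add: grk_loss_solution[OF z] rows)
  also have "\<dots> \<le> (\<Sum>j\<in>J. Max (range (grk_loss A b y)) * (norm (row j A))\<^sup>2)"
    by (intro sum_mono mult_right_mono Max_ge) auto
  finally show ?thesis by (simp add: sum_distrib_left)
qed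

text \<open>
  \<open>M\<close> stands for the squared Frobenius norm at the first step and for \<open>\<gamma>\<close> afterwards. For a
  single row \<open>\<gamma> = 0\<close>, and then \<open>1 / M\<close> is \<open>0\<close> in HOL.
\<close>

lemma grk_step_contraction:
  fixes A :: "real ^ 'n ^ 'm"
  assumes rows: "\<And>i. row i A \<noteq> 0" and z: "A *v z = b"
    and yz: "y - z = transpose A *v w"
    and i: "i \<in> grk_index_set A b y"
    and y': "y' = y - ((row i A \<bullet> y - b $ i) / (norm (row i A))\<^sup>2) *\<^sub>R row i A"
    and M: "(norm (A *v y - b))\<^sup>2 \<le> Max (range (grk_loss A b y)) * M" "M \<ge> 0"
  shows "(norm (y' - z))\<^sup>2 \<le>
    (1 - 1 / 2 * (1 / M + 1 / (frobenius_norm A)\<^sup>2) * (sigma_min A)\<^sup>2) * (norm (y - z))\<^sup>2"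
proof -
  let ?F = "(frobenius_norm A)\<^sup>2" and ?r = "(norm (A *v y - b))\<^sup>2"
  have A0: "A \<noteq> 0" using rows by (auto simp: row_def vec_eq_iff)
  have "grk_loss A b y i \<le> Max (range (grk_loss A b y))" by (intro Max_ge) auto
  moreover have "0 \<le> grk_loss A b y i" by (simp add: grk_loss_def)
  ultimately have max0: "0 \<le> Max (range (grk_loss A b y))" by linarith
  \<comment> \<open>When M = 0 the left side is 0 and \<open>max0\<close> suffices.\<close>
  have maxr: "1 / M * ?r \<le> Max (range (grk_loss A b y))"
    using M max0 by (cases "M = 0") (auto simp: field_simps)
  have "A *v y - b = A *v (y - z)" using z by (simp add: matrix_vector_mult_diff_distrib)
  then have "(sigma_min A)\<^sup>2 * (norm (y - z))\<^sup>2 \<le> ?r"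
    using sigma_min_le_row_space[OF A0, of w] yz by simp
  then have "1 / 2 * (1 / M + 1 / ?F) * ((sigma_min A)\<^sup>2 * (norm (y - z))\<^sup>2)
      \<le> 1 / 2 * (1 / M + 1 / ?F) * ?r"
    using M by (intro mult_left_mono) auto
  also have "\<dots> = 1 / 2 * (1 / M * ?r + ?r / ?F)" by (simp add: algebra_simps)
  also have "\<dots> \<le> grk_loss A b y i"
    using i maxr unfolding grk_index_set_def by (auto simp: field_simps)
  finally show ?thesis
    using kaczmarz_step_error(1)[OF rows z y'] by (simp add: algebra_simps)
qed

section \<open>The convergence bound\<close>

theorem mainTheorem4:
  fixes A :: "real ^ 'n ^ 'm" and b :: "real ^ 'm"
    and x :: "nat \<Rightarrow> real ^ 'n" and idx :: "nat \<Rightarrow> 'm"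
    and xstar :: "real ^ 'n" and k :: nat
  assumes rows_nonzero: "\<And>i. row i A \<noteq> 0"
    and consistent: "\<exists>y. A *v y = b"
    and xstar: "xstar = pseudoinverse A *v b + (mat 1 - pseudoinverse A ** A) *v x 0"
    and grk: "grk_sequence A b idx x"
    and k: "k \<ge> 1"
  shows "(norm (x k - xstar))\<^sup>2 \<le>
           (1 - 1 / 2 * (1 / grk_gamma A * (frobenius_norm A)\<^sup>2 + 1)
                  * ((sigma_min A)\<^sup>2 / (frobenius_norm A)\<^sup>2)) ^ (k - 1)
           * (1 - (sigma_min A)\<^sup>2 / (frobenius_norm A)\<^sup>2)
           * (norm (x 0 - xstar))\<^sup>2"
proof -
  let ?F = "(frobenius_norm A)\<^sup>2" and ?s = "(sigma_min A)\<^sup>2" and ?g = "grk_gamma A"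
  define q where "q = 1 - 1 / 2 * (1 / ?g * ?F + 1) * (?s / ?F)"
  define e where "e j = (norm (x j - xstar))\<^sup>2" for j
  have A0: "A \<noteq> 0" using rows_nonzero by (auto simp: row_def vec_eq_iff)
  have sF: "?s \<le> ?F" by (rule sigma_min_le_frobenius[OF A0])
  have "?s > 0" using sigma_min_nonzero[OF A0] by simp
  with sF have F0: "?F > 0" by linarith
  have z: "A *v xstar = b"
    unfolding xstar by (rule pseudoinverse_projection_solves[OF consistent])
  have step: "x (Suc j) = x j - ((row (idx j) A \<bullet> x j - b $ idx j) / (norm (row (idx j) A))\<^sup>2)
                                   *\<^sub>R row (idx j) A"
    and idx: "idx j \<in> grk_index_set A b (x j)" if "A *v x j \<noteq> b" for j
    using grk that unfolding grk_sequence_def by (auto dest: spec[of _ j])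
  have stop: "x (Suc j) = x j" if "A *v x j = b" for j
    using grk that unfolding grk_sequence_def by (auto dest: spec[of _ j])

  \<comment> \<open>The initial error is the pseudoinverse applied to the initial residual, and each
    step subtracts a multiple of a row.\<close>
  have row_space: "\<exists>w. x j - xstar = transpose A *v w" for j
  proof (induction j)
    case 0
    have "x 0 - xstar = pseudoinverse A *v (A *v x 0 - b)"
      by (simp add: xstar matrix_vector_mult_diff_rdistrib matrix_vector_mult_diff_distrib
          matrix_vector_mul_assoc)
    then show ?case using pseudoinverse_in_row_space by metis
  next
    case (Suc j)
    then obtain w where w: "x j - xstar = transpose A *v w" by blast
    show ?case
    proof (cases "A *v x j = b")
      case True
      then show ?thesis using stop w by auto
    next
      case False
      obtain c where "x (Suc j) = x j - c *\<^sub>R row (idx j) A" using step[OF False] by blast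
      then have "x (Suc j) - xstar = transpose A *v (w - c *\<^sub>R axis (idx j) 1)"
        using w by (simp add: row_in_row_space matrix_vector_mult_diff_distrib
            matrix_vector_mult_scaleR algebra_simps)
      then show ?thesis by blast
    qed
  qed

  have solved: "e j = 0" if "A *v x j = b" for j
  proof -
    obtain w where w: "x j - xstar = transpose A *v w" using row_space by blast
    have "A *v (x j - xstar) = 0" using that z by (simp add: matrix_vector_mult_diff_distrib)
    then show ?thesis using row_space_kernel_trivial[of A w] by (simp add: e_def w)
  qed

  have first: "e 1 \<le> (1 - ?s / ?F) * e 0"
  proof (cases "A *v x 0 = b")
    case True
    then show ?thesis using solved stop[of 0] by (simp add: e_def)
  next
    case False
    obtain w where w: "x 0 - xstar = transpose A *v w" using row_space by blast
    \<comment> \<open>No row has been used yet, so M = |A|_F^2; the two halves of the contraction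
      factor then add up to 1 - \<sigma>^2/|A|_F^2.\<close>
    have "(norm (A *v x 0 - b))\<^sup>2 \<le> Max (range (grk_loss A b (x 0))) * ?F"
      unfolding frobenius_norm_rows by (rule residual_le_max_loss[OF rows_nonzero z]) simp
    from grk_step_contraction[OF rows_nonzero z w idx[OF False] step[OF False] this]
    show ?thesis by (simp add: e_def)
  qed

  have later: "e (Suc (Suc j)) \<le> q * e (Suc j)" for j
  proof (cases "A *v x (Suc j) = b")
    case True
    then show ?thesis using solved stop[of "Suc j"] by (simp add: e_def)
  next
    case False
    \<comment> \<open>Once solved, the system stays solved. So the previous step was a genuine
      projection and row \<open>idx j\<close> now has zero residual.\<close>
    then have False': "A *v x j \<noteq> b" using stop by metis
    obtain w where w: "x (Suc j) - xstar = transpose A *v w" using row_space by blast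
    have "row (idx j) A \<bullet> (x (Suc j) - xstar) = 0"
      by (rule kaczmarz_step_error(2)[OF rows_nonzero z step[OF False']])
    then have "(norm (A *v x (Suc j) - b))\<^sup>2 \<le> Max (range (grk_loss A b (x (Suc j))))
        * (\<Sum>i\<in>UNIV - {idx j}. (norm (row i A))\<^sup>2)"
      by (intro residual_le_max_loss[OF rows_nonzero z]) auto
    \<comment> \<open>The dropped row varies with \<open>j\<close>; \<gamma> bounds the sum of the
      others in every case.\<close>
    also have "\<dots> \<le> Max (range (grk_loss A b (x (Suc j)))) * ?g"
    proof (rule mult_left_mono[OF row_sum_le_grk_gamma])
      have "0 \<le> grk_loss A b (x (Suc j)) (idx j)" by (simp add: grk_loss_def)
      also have "\<dots> \<le> Max (range (grk_loss A b (x (Suc j))))" by (intro Max_ge) auto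
      finally show "0 \<le> Max (range (grk_loss A b (x (Suc j))))" .
    qed
    finally have M: "(norm (A *v x (Suc j) - b))\<^sup>2 \<le> Max (range (grk_loss A b (x (Suc j)))) * ?g" .
    have "q = 1 - 1 / 2 * (1 / ?g + 1 / ?F) * ?s"
      using F0 by (simp add: q_def field_simps)
    then show ?thesis
      using grk_step_contraction[OF rows_nonzero z w idx[OF False] step[OF False] M grk_gamma_nonneg]
      by (simp add: e_def)
  qed

  have main: "e (Suc j) \<le> q ^ j * (1 - ?s / ?F) * e 0" for j
  proof (cases "?s = ?F")
    case True
    \<comment> \<open>The first step already makes the error 0, and \<open>later\<close> preserves
      this whatever the sign of \<open>q\<close>. A single row falls under this case.\<close>
    have "e (Suc j) \<le> 0"
    proof (induction j)
      case 0
      then show ?case using first True F0 by simp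
    next
      case (Suc j)
      then have "e (Suc j) = 0" by (simp add: e_def)
      then show ?case using later[of j] by simp
    qed
    then show ?thesis using True F0 by simp
  next
    case False
    then have sg: "?s \<le> ?g" using sigma_min_le_gamma_or_rank_one[OF rows_nonzero] by blast
    with \<open>?s > 0\<close> have g0: "?g > 0" by linarith
    have "q = 1 - 1 / 2 * (?s / ?g + ?s / ?F)"
      using F0 g0 by (simp add: q_def field_simps)
    moreover have "?s / ?g \<le> 1" "?s / ?F \<le> 1" using sg sF F0 g0 by simp_all
    then have "?s / ?g + ?s / ?F \<le> 2" using add_mono by fastforce
    \<comment> \<open>Nonnegativity of \<open>q\<close> allows the induction hypothesis to be
      multiplied by it.\<close>
    ultimately have q0: "q \<ge> 0" by simp
    show ?thesis
    proof (induction j)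
      case 0
      then show ?case using first by simp
    next
      case (Suc j)
      have "e (Suc (Suc j)) \<le> q * (q ^ j * (1 - ?s / ?F) * e 0)"
        using later[of j] mult_left_mono[OF Suc q0] by linarith
      then show ?case by (simp add: mult.assoc)
    qed
  qed
  \<comment> \<open>The first step has its own factor, so only the remaining k - 1 steps contribute
    powers of \<open>q\<close>.\<close>
  show ?thesis using main[of "k - 1"] k unfolding e_def q_def by simp
qed

end
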